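(* Let $D$ and $L$ be BiHom-Leibniz algebras and suppose given an action of $D$ on $L$. Then the vector space $D\oplus L$ with the bracket $$[(x,a),(y,b)]=\big([x,y],\ [x,b]+[a,y]+[a,b]\big)\qquad (x,y\in D,\ a,b\in L)$$ and the structure maps $\alpha(x,a)=(\alpha(x),\alpha(a))$, $\beta(x,a)=(\beta(x),\beta(a))$ is a BiHom-Leibniz algebra (the semidirect product of $L$ and $D$).
   Context: All vector spaces are over a fixed field. A (right) BiHom-Leibniz algebra is $(L,[\cdot,\cdot],\alpha,\beta)$ with $L$ a vector space, $[\cdot,\cdot]:L\times L\to L$ bilinear and $\alpha,\beta:L\to L$ linear such that $[[x,y],\alpha\beta(z)]=[[x,\beta(z)],\alpha(y)]+[\alpha(x),[y,\alpha(z)]]$ for all $x,y,z\in L$. The structure maps of both $D$ and $L$ are denoted $\alpha,\beta$. An action of $D$ on $L$ is a pair of bilinear maps $D\times L\to L$, $(x,a)\mapsto[x,a]$ and $L\times D\to L$, $(a,x)\mapsto[a,x]$, such that for all $x,y\in D$, $a,b\in L$: $[\alpha(x),[a,\alpha(b)]]=[[x,a],\alpha\beta(b)]-[[x,\beta(b)],\alpha(a)]$; $[\alpha(a),[x,\alpha(b)]]=[[a,x],\alpha\beta(b)]-[[a,\beta(b)],\alpha(x)]$; $[\alpha(a),[b,\alpha(x)]]=[[a,b],\alpha\beta(x)]-[[a,\beta(x)],\alpha(b)]$; $[\alpha(a),[x,\alpha(y)]]=[[a,x],\alpha\beta(y)]-[[a,\beta(y)],\alpha(x)]$; $[\alpha(x),[a,\alpha(y)]]=[[x,a],\alpha\beta(y)]-[[x,\beta(y)],\alpha(a)]$;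 $[\alpha(x),[y,\alpha(a)]]=[[x,y],\alpha\beta(a)]-[[x,\beta(a)],\alpha(y)]$. *)

theory Defs
  imports "HOL-Analysis.Product_Vector"
begin

definition bilinear_map ::
  "('k::field \<Rightarrow> 'a::ab_group_add \<Rightarrow> 'a) \<Rightarrow> ('k \<Rightarrow> 'b::ab_group_add \<Rightarrow> 'b) \<Rightarrow>
   ('k \<Rightarrow> 'c::ab_group_add \<Rightarrow> 'c) \<Rightarrow> ('a \<Rightarrow> 'b \<Rightarrow> 'c) \<Rightarrow> bool"
  where "bilinear_map s1 s2 s3 f \<longleftrightarrow>
    (\<forall>x. Vector_Spaces.linear s2 s3 (\<lambda>y. f x y)) \<and>
    (\<forall>y. Vector_Spaces.linear s1 s3 (\<lambda>x. f x y))"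

text \<open>Right BiHom-Leibniz algebras. The structure maps are only required to be linear: they need
  neither commute nor be multiplicative. The product \<open>\<alpha>\<beta>\<close> is read as the composition \<open>\<alpha> \<circ> \<beta>\<close>.\<close>

locale bihom_leibniz_algebra = vector_space scale
  for scale :: "'k::field \<Rightarrow> 'a::ab_group_add \<Rightarrow> 'a" +
  fixes br :: "'a \<Rightarrow> 'a \<Rightarrow> 'a"
    and \<alpha> \<beta> :: "'a \<Rightarrow> 'a"
  assumes bilinear_br: "bilinear_map scale scale scale br"
    and linear_\<alpha>: "Vector_Spaces.linear scale scale \<alpha>"
    and linear_\<beta>: "Vector_Spaces.linear scale scale \<beta>"
    and bihom_leibniz:
      "br (br x y) (\<alpha> (\<beta> z)) = br (br x (\<beta> z)) (\<alpha> y) + br (\<alpha> x) (br y (\<alpha> z))"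

text \<open>An action of \<open>D\<close> on \<open>L\<close>: \<open>l x a\<close> is \<open>[x, a]\<close> and \<open>r a x\<close> is \<open>[a, x]\<close>
  for \<open>x\<close> in \<open>D\<close> and \<open>a\<close> in \<open>L\<close>.\<close>

locale bihom_leibniz_action =
  D: bihom_leibniz_algebra sD brD \<alpha>D \<beta>D + L: bihom_leibniz_algebra sL brL \<alpha>L \<beta>L
  for sD :: "'k::field \<Rightarrow> 'd::ab_group_add \<Rightarrow> 'd"
    and brD :: "'d \<Rightarrow> 'd \<Rightarrow> 'd" and \<alpha>D \<beta>D :: "'d \<Rightarrow> 'd"
    and sL :: "'k \<Rightarrow> 'l::ab_group_add \<Rightarrow> 'l"
    and brL :: "'l \<Rightarrow> 'l \<Rightarrow> 'l" and \<alpha>L \<beta>L :: "'l \<Rightarrow> 'l" +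
  fixes l :: "'d \<Rightarrow> 'l \<Rightarrow> 'l" and r :: "'l \<Rightarrow> 'd \<Rightarrow> 'l"
  assumes bilinear_l: "bilinear_map sD sL sL l"
    and bilinear_r: "bilinear_map sL sD sL r"
    and action_DLL:
      "l (\<alpha>D x) (brL a (\<alpha>L b)) = brL (l x a) (\<alpha>L (\<beta>L b)) - brL (l x (\<beta>L b)) (\<alpha>L a)"
    and action_LDL:
      "brL (\<alpha>L a) (l x (\<alpha>L b)) = brL (r a x) (\<alpha>L (\<beta>L b)) - r (brL a (\<beta>L b)) (\<alpha>D x)"
    and action_LLD:
      "brL (\<alpha>L a) (r b (\<alpha>D x)) = r (brL a b) (\<alpha>D (\<beta>D x)) - brL (r a (\<beta>D x)) (\<alpha>L b)"
    and action_LDD: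
      "r (\<alpha>L a) (brD x (\<alpha>D y)) = r (r a x) (\<alpha>D (\<beta>D y)) - r (r a (\<beta>D y)) (\<alpha>D x)"
    and action_DLD:
      "l (\<alpha>D x) (r a (\<alpha>D y)) = r (l x a) (\<alpha>D (\<beta>D y)) - l (brD x (\<beta>D y)) (\<alpha>L a)"
    and action_DDL:
      "l (\<alpha>D x) (l y (\<alpha>L a)) = l (brD x y) (\<alpha>L (\<beta>L a)) - r (l x (\<beta>L a)) (\<alpha>D y)"

fun semidirect_br ::
  "('d \<Rightarrow> 'd \<Rightarrow> 'd) \<Rightarrow> ('l \<Rightarrow> 'l \<Rightarrow> 'l::ab_group_add) \<Rightarrow> ('d \<Rightarrow> 'l \<Rightarrow> 'l) \<Rightarrow> ('l \<Rightarrow> 'd \<Rightarrow> 'l) \<Rightarrow>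
   'd \<times> 'l \<Rightarrow> 'd \<times> 'l \<Rightarrow> 'd \<times> 'l"
  where "semidirect_br brD brL l r (x, a) (y, b) = (brD x y, l x b + r a y + brL a b)"

end

theory Submission
  imports Defs
begin

text \<open>Everything about the first component is inherited from \<open>D\<close>. In the second component both sides
  of the BiHom-Leibniz identity for \<open>(x, a)\<close>, \<open>(y, b)\<close>, \<open>(z, c)\<close> expand by biadditivity into sums of
  brackets in which each argument is taken either from \<open>D\<close> or from \<open>L\<close>. Sorted by these choices, the
  three choices with exactly one argument in \<open>L\<close> and the three with exactly two give precisely the six
  axioms of an action, and the choice of all three in \<open>L\<close> gives the identity of \<open>L\<close>.\<close>

lemma bilinear_map_add:
  assumes "bilinear_map s1 s2 s3 f"
  shows "f (x + x') y = f x y + f x' y" and "f x (y + y') = f x y + f x y'"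
  using assms by (simp_all add: bilinear_map_def linear_iff_module_hom module_hom_iff)

lemma bilinear_map_scale:
  assumes "bilinear_map s1 s2 s3 f"
  shows "f (s1 c x) y = s3 c (f x y)" and "f x (s2 c y) = s3 c (f x y)"
  using assms by (simp_all add: bilinear_map_def linear_iff_module_hom module_hom_iff)

lemma linear_map_prod_scale:
  assumes f: "Vector_Spaces.linear s1 s1' f" and g: "Vector_Spaces.linear s2 s2' g"
  shows "Vector_Spaces.linear (module_prod.scale s1 s2) (module_prod.scale s1' s2')
           (\<lambda>(x, a). (f x, g a))"
proof -
  interpret f: Vector_Spaces.linear s1 s1' f by (rule f)
  interpret g: Vector_Spaces.linear s2 s2' g by (rule g)
  interpret P: vector_space_prod s1 s2 ..
  interpret Q: vector_space_prod s1' s2' ..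
  show ?thesis
    by unfold_locales
      (auto simp: P.scale_def Q.scale_def f.add g.add f.scale g.scale)
qed

context bihom_leibniz_action
begin

sublocale P: vector_space_prod sD sL ..

lemma bilinear_semidirect_br:
  "bilinear_map P.scale P.scale P.scale (semidirect_br brD brL l r)"
proof -
  note scaling = bilinear_map_scale[OF D.bilinear_br] bilinear_map_scale[OF L.bilinear_br]
    bilinear_map_scale[OF bilinear_l] bilinear_map_scale[OF bilinear_r]
  note additive = bilinear_map_add[OF D.bilinear_br] bilinear_map_add[OF L.bilinear_br]
    bilinear_map_add[OF bilinear_l] bilinear_map_add[OF bilinear_r]
  show ?thesis
    unfolding bilinear_map_def linear_iff_module_hom module_hom_iff
    by (auto simp: P.scale_def additive scaling L.scale_right_distrib P.p.module_axioms)
qed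

lemma semidirect_bihom_leibniz:
  fixes x y z :: 'd and a b c :: 'l
  defines "br \<equiv> semidirect_br brD brL l r"
  shows "br (br (x, a) (y, b)) (\<alpha>D (\<beta>D z), \<alpha>L (\<beta>L c)) =
         br (br (x, a) (\<beta>D z, \<beta>L c)) (\<alpha>D y, \<alpha>L b) +
         br (\<alpha>D x, \<alpha>L a) (br (y, b) (\<alpha>D z, \<alpha>L c))"
proof -
  note additive = bilinear_map_add[OF L.bilinear_br]
    bilinear_map_add[OF bilinear_l] bilinear_map_add[OF bilinear_r]
  show ?thesis
    unfolding br_def
    by (simp add: additive D.bihom_leibniz L.bihom_leibniz
        action_DLL action_LDL action_LLD action_LDD action_DLD action_DDL)
qed

end

theorem lemma2p45:
  fixes sD :: "'k::field \<Rightarrow> 'd::ab_group_add \<Rightarrow> 'd"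
    and brD :: "'d \<Rightarrow> 'd \<Rightarrow> 'd" and \<alpha>D \<beta>D :: "'d \<Rightarrow> 'd"
    and sL :: "'k \<Rightarrow> 'l::ab_group_add \<Rightarrow> 'l"
    and brL :: "'l \<Rightarrow> 'l \<Rightarrow> 'l" and \<alpha>L \<beta>L :: "'l \<Rightarrow> 'l"
    and l :: "'d \<Rightarrow> 'l \<Rightarrow> 'l" and r :: "'l \<Rightarrow> 'd \<Rightarrow> 'l"
  assumes "bihom_leibniz_algebra sD brD \<alpha>D \<beta>D"
    and "bihom_leibniz_algebra sL brL \<alpha>L \<beta>L"
    and "bihom_leibniz_action sD brD \<alpha>D \<beta>D sL brL \<alpha>L \<beta>L l r"
  shows "bihom_leibniz_algebra (module_prod.scale sD sL) (semidirect_br brD brL l r)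
           (\<lambda>(x, a). (\<alpha>D x, \<alpha>L a)) (\<lambda>(x, a). (\<beta>D x, \<beta>L a))"
proof -
  interpret bihom_leibniz_action sD brD \<alpha>D \<beta>D sL brL \<alpha>L \<beta>L l r
    by (rule assms(3))
  show ?thesis
  proof (intro bihom_leibniz_algebra.intro bihom_leibniz_algebra_axioms.intro)
    show "vector_space P.scale" ..
    show "bilinear_map P.scale P.scale P.scale (semidirect_br brD brL l r)"
      by (rule bilinear_semidirect_br)
    show "Vector_Spaces.linear P.scale P.scale (\<lambda>(x, a). (\<alpha>D x, \<alpha>L a))"
      by (rule linear_map_prod_scale[OF D.linear_\<alpha> L.linear_\<alpha>])
    show "Vector_Spaces.linear P.scale P.scale (\<lambda>(x, a). (\<beta>D x, \<beta>L a))"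
      by (rule linear_map_prod_scale[OF D.linear_\<beta> L.linear_\<beta>])
  qed (use semidirect_bihom_leibniz in \<open>simp del: semidirect_br.simps split: prod.split\<close>)
qed

end
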